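(* Let $n\ge 4$. For integers $a,a'$ with $0\le a<a'\le\lfloor\frac{n-4}{2}\rfloor$, $$\xi_2\big((T_{n,3}^{a,n-4-a})^c\big)<\xi_2\big((T_{n,3}^{a',n-4-a'})^c\big).$$ That is, $\xi_2\big((T_{n,3}^{0,n-4})^c\big)<\xi_2\big((T_{n,3}^{1,n-5})^c\big)<\cdots<\xi_2\big((T_{n,3}^{\lfloor\frac{n-4}{2}\rfloor,\lceil\frac{n-4}{2}\rceil})^c\big)$.
   Context: For a connected graph $G$, the eccentricity matrix $\mathcal{E}(G)$ is the matrix indexed by $V(G)$ whose $(u,v)$-entry is $d_G(u,v)$ if $d_G(u,v)=\min\{e_G(u),e_G(v)\}$ and $0$ otherwise, where $d_G$ is the graph distance and $e_G(u)=\max_v d_G(u,v)$. Its eigenvalues are ordered $\xi_1(G)\ge\xi_2(G)\ge\cdots$; $\xi_2(G)$ is the second largest. $T^c$ is the complement of $T$. For $b\ge a\ge0$ with $a+b=n-4$, $T_{n,3}^{a,b}$ is the tree obtained from the path $v_0v_1v_2v_3$ by attaching $a$ pendant vertices to $v_1$ and $b$ pendant vertices to $v_2$. *)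

theory Defs
  imports "Graph_Theory.Graph_Theory" "Jordan_Normal_Form.Char_Poly"
begin

text \<open>Finite simple graphs are the graphs of the locale \<^locale>\<open>pair_graph\<close>: an undirected
  edge \<open>uv\<close> is represented by the two arcs \<open>(u, v)\<close> and \<open>(v, u)\<close>.\<close>

definition graph_complement :: "'a pair_pre_digraph \<Rightarrow> 'a pair_pre_digraph" where
  "graph_complement G = \<lparr> pverts = pverts G,
     parcs = {(u, v). u \<in> pverts G \<and> v \<in> pverts G \<and> u \<noteq> v \<and> (u, v) \<notin> parcs G} \<rparr>"

definition graph_dist :: "'a pair_pre_digraph \<Rightarrow> 'a \<Rightarrow> 'a \<Rightarrow> ereal" where
  "graph_dist G u v = wf_digraph.\<mu> (with_proj G) (\<lambda>_. 1) u v"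

definition eccentricity :: "'a pair_pre_digraph \<Rightarrow> 'a \<Rightarrow> ereal" where
  "eccentricity G u = Max (graph_dist G u ` pverts G)"

text \<open>Matrix indices are natural numbers, so the vertices are listed in increasing order.
  For connected \<open>G\<close> all distances are finite and \<^const>\<open>real_of_ereal\<close> loses nothing.\<close>

definition ecc_matrix :: "'a::linorder pair_pre_digraph \<Rightarrow> real mat" where
  "ecc_matrix G =
     (let vs = sorted_list_of_set (pverts G); n = card (pverts G)
      in mat n n (\<lambda>(i, j).
           let u = vs ! i; v = vs ! j
           in if graph_dist G u v = min (eccentricity G u) (eccentricity G v)
              then real_of_ereal (graph_dist G u v) else 0))"

text \<open>The real eigenvalues, in decreasing order and repeated according to algebraic
  multiplicity. As \<^const>\<open>ecc_matrix\<close> is real symmetric, these are all its eigenvalues.\<close>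

definition eigvals_desc :: "real mat \<Rightarrow> real list" where
  "eigvals_desc A = rev (sorted_list_of_multiset (proots (char_poly A)))"

text \<open>The eigenvalues are numbered from 1, lists from 0.\<close>

definition ecc_eigval :: "nat \<Rightarrow> 'a::linorder pair_pre_digraph \<Rightarrow> real" ("\<xi>") where
  "\<xi> k G = eigvals_desc (ecc_matrix G) ! (k - 1)"

text \<open>The tree \<open>T_{n,3}^{a,b}\<close> with \<open>n = a + b + 4\<close>. The path \<open>v_0 v_1 v_2 v_3\<close> is
  \<open>0, 1, 2, 3\<close>; the pendant vertices at \<open>v_1\<close> are \<open>4, \<dots>, a + 3\<close>, those at \<open>v_2\<close> are
  \<open>a + 4, \<dots>, a + b + 3\<close>.\<close>

definition tree3 :: "nat \<Rightarrow> nat \<Rightarrow> nat pair_pre_digraph" where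
  "tree3 a b =
     (let E = {(0, 1), (1, 2), (2, 3)} \<union> {1} \<times> {4..<a + 4} \<union> {2} \<times> {a + 4..<a + b + 4}
      in \<lparr> pverts = {..<a + b + 4}, parcs = E \<union> E\<inverse> \<rparr>)"

lemma pair_graph_complement:
  assumes "pair_graph G"
  shows "pair_graph (graph_complement G)"
proof -
  interpret pair_graph G by fact
  have "parcs (graph_complement G) \<subseteq> pverts G \<times> pverts G"
    by (auto simp: graph_complement_def)
  then have "finite (parcs (graph_complement G))"
    using finite_subset pair_finite_verts by blast
  moreover have "sym (parcs G)"
    using pair_sym_arcs by (simp add: symmetric_def)
  ultimately show ?thesis
    using pair_finite_verts
    by unfold_locales (auto simp: graph_complement_def symmetric_def sym_def)
qed

lemma pair_graph_tree3: "pair_graph (tree3 a b)"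
  by unfold_locales (auto simp: tree3_def Let_def symmetric_def sym_def)

lemma connected_complement_tree3:
  "strongly_connected (with_proj (graph_complement (tree3 a b)))"
proof -
  let ?H = "graph_complement (tree3 a b)"
  interpret pair_graph ?H
    by (intro pair_graph_complement pair_graph_tree3)
  have sym: "symmetric (with_proj ?H)"
    by (rule pair_sym_arcs)
  have arc: "u \<rightarrow>\<^sup>*\<^bsub>with_proj ?H\<^esub> v" if "(u, v) \<in> parcs ?H" for u v
    using that by (intro reachable_adjI) simp
  have 03: "0 \<rightarrow>\<^sup>*\<^bsub>with_proj ?H\<^esub> 3" and 31: "3 \<rightarrow>\<^sup>*\<^bsub>with_proj ?H\<^esub> 1" and 02: "0 \<rightarrow>\<^sup>*\<^bsub>with_proj ?H\<^esub> 2"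
    by (rule arc, simp add: graph_complement_def tree3_def Let_def)+
  have ge4: "0 \<rightarrow>\<^sup>*\<^bsub>with_proj ?H\<^esub> v" if "4 \<le> v" "v < a + b + 4" for v
    using that by (intro arc) (auto simp: graph_complement_def tree3_def Let_def)
  have from0: "0 \<rightarrow>\<^sup>*\<^bsub>with_proj ?H\<^esub> v" if "v \<in> pverts ?H" for v
  proof -
    have "v < a + b + 4"
      using that by (simp add: graph_complement_def tree3_def Let_def)
    then consider "v = 0" | "v = 1" | "v = 2" | "v = 3" | "4 \<le> v" "v < a + b + 4"
      by linarith
    then show ?thesis
      using 03 31 02 ge4 that by cases (auto intro: reachable_trans)
  qed
  have "0 \<in> pverts ?H"
    by (simp add: graph_complement_def tree3_def Let_def)
  then have "pverts ?H \<noteq> {}"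
    by blast
  moreover have "u \<rightarrow>\<^sup>*\<^bsub>with_proj ?H\<^esub> v" if "u \<in> pverts ?H" "v \<in> pverts ?H" for u v
    using symmetric_reachable[OF sym from0[OF that(1)]] from0[OF that(2)] by (rule reachable_trans)
  ultimately show ?thesis
    by (simp add: strongly_connected_def)
qed

end

theory Submission
  imports Defs
begin

text \<open>In the complement of the double star, non-adjacent vertices of the tree have
  distance 1, so only tree edges survive in the eccentricity matrix: weight 3 on the edge between
  the centres, weight 2 on the pendant edges. With \<open>p = a + 1\<close> and \<open>q = b + 1\<close> leaves at the two
  centres, leaves at the same centre give equal columns, so the characteristic polynomial is
  \<open>x\<close> to the power \<open>a + b\<close> times that of a tridiagonal 4-by-4 quotient, the biquadratic
  \<open>x^4 - s x^2 + 16 p q\<close> with \<open>s = 4 (p + q) + 9\<close>. Writing its roots as \<open>(\<plusminus> u \<plusminus> w) / 2\<close>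
  gives \<open>u^2 = s + t\<close> and \<open>w^2 = s - t\<close> for \<open>t = 8 sqrt (p q)\<close>, hence
  \<open>2 \<xi>\<^sub>2 = sqrt (s + t) - sqrt (s - t)\<close>. For fixed \<open>n\<close> the number \<open>s\<close> is constant, and
  this is increasing in \<open>p q\<close>.\<close>

section \<open>Characteristic polynomials: dependent columns, tridiagonal quotient\<close>

text \<open>Column operations clear the dependent columns; the inverse row operations turn the upper
  left block into \<open>A + N * C\<close>.\<close>

lemma char_poly_four_block_dependent_cols:
  fixes A :: "'a :: field mat"
  assumes A: "A \<in> carrier_mat n n" and C: "C \<in> carrier_mat m n" and N: "N \<in> carrier_mat n m"
  shows "char_poly (four_block_mat A (A * N) C (C * N)) = char_poly (A + N * C) * [:0, 1:] ^ m"
proof -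
  let ?M = "four_block_mat A (A * N) C (C * N)"
  let ?T = "four_block_mat (A + N * C) (0\<^sub>m n m) C (0\<^sub>m m m)"
  let ?P = "four_block_mat (1\<^sub>m n) (- N) (0\<^sub>m m n) (1\<^sub>m m)"
  let ?Q = "four_block_mat (1\<^sub>m n) N (0\<^sub>m m n) (1\<^sub>m m)"
  have I: "1\<^sub>m n \<in> carrier_mat n n" "1\<^sub>m m \<in> carrier_mat m m"
    "0\<^sub>m m n \<in> carrier_mat m n" "0\<^sub>m n m \<in> carrier_mat n m" "0\<^sub>m m m \<in> carrier_mat m m"
    "- N \<in> carrier_mat n m" "A + N * C \<in> carrier_mat n n"
    using assms by auto
  have neg0: "- 0\<^sub>m m m + 1\<^sub>m m = (1\<^sub>m m :: 'a mat)"
    by (intro eq_matI) auto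
  have N0: "N + - N = 0\<^sub>m n m"
    using N by (intro eq_matI) auto
  have PQ: "?P * ?Q = 1\<^sub>m (n + m)"
    by (subst mult_four_block_mat[OF I(1,6,3,2) I(1) N I(3,2)])
      (use N in \<open>simp add: neg0 N0 uminus_l_inv_mat\<close>)
  have QP: "?Q * ?P = 1\<^sub>m (n + m)"
    by (subst mult_four_block_mat[OF I(1) N I(3,2) I(1,6,3,2)])
      (use N in \<open>simp add: neg0 N0 uminus_l_inv_mat\<close>)
  have "?P * ?T = four_block_mat A (0\<^sub>m n m) C (0\<^sub>m m m)"
  proof (subst mult_four_block_mat[OF I(1,6,3,2) I(7,4) C I(5)], rule cong_four_block_mat)
    show "1\<^sub>m n * (A + N * C) + - N * C = A"
      using A N C by (intro eq_matI) (auto simp: scalar_prod_def sum_negf)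
  qed (use assms in auto)
  then have "?P * ?T * ?Q = four_block_mat A (0\<^sub>m n m) C (0\<^sub>m m m) * ?Q"
    by simp
  also have "\<dots> = ?M"
    by (subst mult_four_block_mat[OF A I(4) C I(5) I(1) N I(3,2)], rule cong_four_block_mat)
      (use assms in auto)
  finally have "similar_mat ?M ?T"
    using assms PQ QP by (intro similar_matI[of _ _ ?P ?Q "n + m"]) auto
  then have "char_poly ?M = char_poly ?T"
    by (rule char_poly_similar)
  also have "\<dots> = det (four_block_mat (char_poly_matrix (A + N * C)) (0\<^sub>m n m)
      (map_mat (\<lambda>x. [:- x:]) C) ([:0, 1:] \<cdot>\<^sub>m 1\<^sub>m m))"
    unfolding char_poly_def
    by (rule arg_cong[of _ _ det], rule eq_matI) (use assms in \<open>auto simp: char_poly_matrix_def\<close>)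
  also have "\<dots> = det (char_poly_matrix (A + N * C)) * det ([:0, 1:] \<cdot>\<^sub>m 1\<^sub>m m :: 'a poly mat)"
    using assms by (intro det_four_block_mat_upper_right_zero) auto
  finally show ?thesis
    by (simp add: char_poly_def)
qed

text \<open>The first four indices are the path; then come the pendant vertices at vertex 1, then
  those at vertex 2. Hence the last \<open>a + b\<close> columns repeat column 0 or column
  3.\<close>

definition double_star_mat :: "nat \<Rightarrow> nat \<Rightarrow> real mat" where
  "double_star_mat a b =
     four_block_mat
       (mat_of_rows_list 4 [[0, 2, 0, 0], [2, 0, 3, 0], [0, 3, 0, 2], [0, 0, 2, 0]])
       (mat 4 (a + b) (\<lambda>(i, j). if i = 1 \<and> j < a \<or> i = 2 \<and> a \<le> j then 2 else 0))
       (mat (a + b) 4 (\<lambda>(i, j). if j = 1 \<and> i < a \<or> j = 2 \<and> a \<le> i then 2 else 0))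
       (0\<^sub>m (a + b) (a + b))"

lemma mat_of_rows_list_simps [simp]:
  "dim_row (mat_of_rows_list n rs) = length rs"
  "dim_col (mat_of_rows_list n rs) = n"
  "i < length rs \<Longrightarrow> j < n \<Longrightarrow> mat_of_rows_list n rs $$ (i, j) = rs ! i ! j"
  by (simp_all add: mat_of_rows_list_def)

lemma less_4_cases: "i < (4::nat) \<Longrightarrow> i = 0 \<or> i = 1 \<or> i = 2 \<or> i = 3"
  by auto

lemma sum_if_less:
  fixes a b :: nat and c :: real
  shows "(\<Sum>j = 0..<a + b. if j < a then c else 0) = c * a"
    and "(\<Sum>j = 0..<a + b. if a \<le> j then c else 0) = c * b"
proof -
  have *: "{0..<a + b} = {0..<a} \<union> {a..<a + b}"
    by auto
  show "(\<Sum>j = 0..<a + b. if j < a then c else 0) = c * a"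
    "(\<Sum>j = 0..<a + b. if a \<le> j then c else 0) = c * b"
    unfolding * by (subst sum.union_disjoint; simp)+
qed

text \<open>Expansion along the first row, with the minors again in the form \<open>mat n n\<close>,
  so that rewriting can repeat it down to size 0.\<close>

lemma det_mat_Suc:
  fixes f :: "nat \<times> nat \<Rightarrow> 'a :: comm_ring_1"
  shows "det (mat (Suc n) (Suc n) f) =
    (\<Sum>j<Suc n. f (0, j) * ((-1) ^ j * det (mat n n (\<lambda>(i, k). f (Suc i, if k < j then k else Suc k)))))"
proof -
  have *: "mat_delete (mat (Suc n) (Suc n) f) 0 j =
      mat n n (\<lambda>(i, k). f (Suc i, if k < j then k else Suc k))" if "j < Suc n" for j
    using that by (intro eq_matI) (auto simp: mat_delete_def)
  show ?thesis
    by (subst laplace_expansion_row[of _ "Suc n" 0]) (auto simp: cofactor_def * intro!: sum.cong)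
qed

text \<open>The coefficients are signed sums over matchings of a path on four vertices, edge
  \<open>i\<close> having weight \<open>xi * yi\<close>; the constant term is the perfect
  matching.\<close>

lemma char_poly_tridiagonal_4:
  fixes x1 x2 x3 y1 y2 y3 :: "'a :: field"
  shows "char_poly (mat_of_rows_list 4 [[0, x1, 0, 0], [y1, 0, x2, 0], [0, y2, 0, x3], [0, 0, y3, 0]])
    = [:x1 * y1 * x3 * y3, 0, - (x1 * y1 + x2 * y2 + x3 * y3), 0, 1:]"
proof -
  \<comment> \<open>The size 4 is spelled in successors so that \<open>det_mat_Suc\<close>
    applies.\<close>
  have "char_poly_matrix (mat_of_rows_list 4
      [[0, x1, 0, 0], [y1, 0, x2, 0], [0, y2, 0, x3], [0, 0, y3, 0]]) =
    mat (Suc (Suc (Suc (Suc 0)))) (Suc (Suc (Suc (Suc 0)))) (\<lambda>(i, j).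
      [[[:0, 1:], [:-x1:], 0, 0], [[:-y1:], [:0, 1:], [:-x2:], 0],
       [0, [:-y2:], [:0, 1:], [:-x3:]], [0, 0, [:-y3:], [:0, 1:]]] ! i ! j)"
    by (intro eq_matI) (auto simp: char_poly_matrix_def mat_of_rows_list_def less_Suc_eq)
  then show ?thesis
    unfolding char_poly_def by (simp add: det_mat_Suc algebra_simps)
qed

lemma char_poly_double_star_mat:
  "char_poly (double_star_mat a b) =
    [:16 * real (a + 1) * real (b + 1), 0, - (4 * real (a + 1) + 4 * real (b + 1) + 9), 0, 1:] * [:0, 1:] ^ (a + b)"
proof -
  let ?A = "mat_of_rows_list 4 [[0, 2, 0, 0], [2, 0, 3, 0], [0, 3, 0, 2], [0, 0, 2, 0]] :: real mat"
  \<comment> \<open>Column \<open>j\<close> of \<open>?N\<close> selects the path end, 0 or 3, that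
    is attached to the same centre as the pendant vertex \<open>j\<close>.\<close>
  let ?N = "mat 4 (a + b) (\<lambda>(i, j). if i = 0 \<and> j < a \<or> i = 3 \<and> a \<le> j then 1 else 0) :: real mat"
  let ?C = "mat (a + b) 4 (\<lambda>(i, j). if j = 1 \<and> i < a \<or> j = 2 \<and> a \<le> i then 2 else 0) :: real mat"
  have A: "?A \<in> carrier_mat 4 4" by auto
  have C: "?C \<in> carrier_mat (a + b) 4" by auto
  have N: "?N \<in> carrier_mat 4 (a + b)" by auto
  have AN: "?A * ?N = mat 4 (a + b) (\<lambda>(i, j). if i = 1 \<and> j < a \<or> i = 2 \<and> a \<le> j then 2 else 0)"
    by (intro eq_matI) (auto simp: scalar_prod_def numeral_eq_Suc less_Suc_eq)
  have CN: "?C * ?N = 0\<^sub>m (a + b) (a + b)"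
    by (intro eq_matI) (auto simp: scalar_prod_def numeral_eq_Suc)
  \<comment> \<open>The \<open>a\<close> copies of column 0 and the \<open>b\<close> copies of
    column 3 are merged into weights: entry (0, 1) gains \<open>2 * a\<close>, entry (3, 2) gains
    \<open>2 * b\<close>.\<close>
  have NC: "?A + ?N * ?C = mat_of_rows_list 4
      [[0, 2 * real (a + 1), 0, 0], [2, 0, 3, 0], [0, 3, 0, 2], [0, 0, 2 * real (b + 1), 0]]"
    by (intro eq_matI)
      (auto simp: scalar_prod_def if_distrib[of "\<lambda>x. x * _"] sum_if_less
        numeral_eq_Suc less_Suc_eq cong: if_cong)
  show ?thesis
    using char_poly_four_block_dependent_cols[OF A C N]
    unfolding AN CN NC double_star_mat_def[symmetric] char_poly_tridiagonal_4
    by (simp add: algebra_simps)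
qed

section \<open>Recognising distances up to 3\<close>

context pair_wf_digraph
begin

lemma awalk_cost_one: "awalk_cost (\<lambda>_. 1) p = length p"
  by (induction p) simp_all

lemma graph_dist_le: "awalk u p v \<Longrightarrow> graph_dist G u v \<le> length p"
  using min_cost_le_walk_cost[of u p v "\<lambda>_. 1"] by (simp add: graph_dist_def awalk_cost_one)

lemma graph_dist_eqI:
  assumes "awalk u p v" "length p = k" and "\<And>q. awalk u q v \<Longrightarrow> k \<le> length q"
  shows "graph_dist G u v = k"
proof (rule antisym)
  show "graph_dist G u v \<le> k" using graph_dist_le assms by blast
  show "ereal k \<le> graph_dist G u v"
    unfolding graph_dist_def \<mu>_def using assms(3) by (intro INF_greatest) (simp add: awalk_cost_one)
qed

lemma graph_dist_0: "u \<in> pverts G \<Longrightarrow> graph_dist G u u = ereal 0"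
  using graph_dist_eqI[of u "[]" u 0] by (simp add: awalk_Nil_iff)

lemma graph_dist_1:
  assumes "(u, v) \<in> parcs G" "u \<noteq> v"
  shows "graph_dist G u v = ereal 1"
proof -
  have "1 \<le> length q" if "awalk u q v" for q
    using that assms(2) by (cases q) (auto simp: awalk_Nil_iff)
  moreover have "awalk u [(u, v)] v"
    using assms(1) by (auto simp: awalk_Cons_iff awalk_Nil_iff dest: in_arcsD2)
  ultimately show ?thesis
    using graph_dist_eqI[of u _ v 1] by fastforce
qed

lemma graph_dist_2:
  assumes "(u, w) \<in> parcs G" "(w, v) \<in> parcs G" "u \<noteq> v" "(u, v) \<notin> parcs G"
  shows "graph_dist G u v = ereal 2"
proof -
  have "2 \<le> length q" if "awalk u q v" for q
  proof (rule ccontr)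
    assume "\<not> 2 \<le> length q"
    then have "length q = 0 \<or> length q = 1" by linarith
    then show False
      using that assms(3,4) by (auto simp: awalk_Cons_iff awalk_Nil_iff length_Suc_conv)
  qed
  moreover have "awalk u [(u, w), (w, v)] v"
    using assms by (auto simp: awalk_Cons_iff awalk_Nil_iff dest: in_arcsD2)
  ultimately show ?thesis
    using graph_dist_eqI[of u _ v 2] by fastforce
qed

text \<open>Distinct ends, no arc and no common intermediate vertex exclude walks of length 0, 1 and
  2 in turn.\<close>

lemma graph_dist_3:
  assumes "(u, w) \<in> parcs G" "(w, x) \<in> parcs G" "(x, v) \<in> parcs G" "u \<noteq> v" "(u, v) \<notin> parcs G"
    and no_common: "\<And>y. (u, y) \<in> parcs G \<Longrightarrow> (y, v) \<notin> parcs G"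
  shows "graph_dist G u v = ereal 3"
proof -
  have "3 \<le> length q" if "awalk u q v" for q
  proof (rule ccontr)
    assume "\<not> 3 \<le> length q"
    then have "length q = 0 \<or> length q = 1 \<or> length q = 2" by linarith
    then show False
      using that assms(4-) by (auto simp: awalk_Cons_iff awalk_Nil_iff length_Suc_conv numeral_2_eq_2)
  qed
  moreover have "awalk u [(u, w), (w, x), (x, v)] v"
    using assms by (auto simp: awalk_Cons_iff awalk_Nil_iff dest: in_arcsD2)
  ultimately show ?thesis
    using graph_dist_eqI[of u _ v 3] by fastforce
qed

end

section \<open>Ordering the roots, and monotonicity in \<open>t\<close>\<close>

lemma rev_sorted_proots_biquadratic:
  fixes u w :: real
  assumes "0 < w" "w < u"
  defines "r \<equiv> (u + w) / 2" and "s \<equiv> (u - w) / 2"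
  shows "rev (sorted_list_of_multiset (proots
      ([:((u\<^sup>2 - w\<^sup>2) / 4)\<^sup>2, 0, - ((u\<^sup>2 + w\<^sup>2) / 2), 0, 1:] * [:0, 1:] ^ k)))
    = [r, s] @ replicate k 0 @ [- s, - r]"
proof -
  have "0 < s" "s < r" using assms by (auto simp: r_def s_def)
  \<comment> \<open>Here \<open>r * s\<close> is a quarter of the difference of the squares of
    \<open>u\<close> and \<open>w\<close>, and the squares of \<open>r\<close> and \<open>s\<close>
    add up to half their sum.\<close>
  have "[:((u\<^sup>2 - w\<^sup>2) / 4)\<^sup>2, 0, - ((u\<^sup>2 + w\<^sup>2) / 2), 0, 1:] =
      [:- r, 1:] * ([:r, 1:] * ([:- s, 1:] * [:s, 1:]))"
    by (simp add: r_def s_def power2_eq_square field_simps)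
  then have "proots ([:((u\<^sup>2 - w\<^sup>2) / 4)\<^sup>2, 0, - ((u\<^sup>2 + w\<^sup>2) / 2), 0, 1:] * [:0, 1:] ^ k) =
      mset ([- r, - s] @ replicate k 0 @ [s, r])"
    by (simp add: proots_mult proots_power del: mult_pCons_left mult_pCons_right)
  moreover have "sorted ([- r, - s] @ replicate k 0 @ [s, r])"
    using \<open>0 < s\<close> \<open>s < r\<close> by (auto simp: sorted_append)
  ultimately show ?thesis
    by (simp add: sorted_sort_id del: mset_append mset.simps append.simps)
qed

text \<open>Raising \<open>t\<close> enlarges the minuend and shrinks the subtrahend.\<close>

lemma sqrt_diff_less:
  fixes s t t' :: real
  assumes "t < t'" "0 \<le> t" "t' \<le> s"
  shows "sqrt (s + t) - sqrt (s - t) < sqrt (s + t') - sqrt (s - t')"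
  using assms by (intro diff_strict_mono[OF real_sqrt_less_mono real_sqrt_less_mono]) auto

section \<open>The eccentricity matrix of the complement\<close>

text \<open>The ends of a pendant edge at 1 have the common complement neighbour 3; at 2 it is 0.
  The centres have none, since every other vertex is a tree neighbour of one of them; the walk 1, 3,
  0, 2 joins them.\<close>

lemma graph_dist_complement_tree3:
  assumes "u < a + b + 4" "v < a + b + 4"
  shows "graph_dist (graph_complement (tree3 a b)) u v =
    ereal (if u = v then 0 else if (u, v) \<notin> parcs (tree3 a b) then 1
      else if u \<in> {1, 2} \<and> v \<in> {1, 2} then 3 else 2)"
proof -
  let ?H = "graph_complement (tree3 a b)"
  interpret pair_graph ?H
    by (intro pair_graph_complement pair_graph_tree3)
  note defs = graph_complement_def tree3_def Let_def
  consider (eq) "u = v" | (nonadj) "u \<noteq> v" "(u, v) \<notin> parcs (tree3 a b)"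
    | (c12) "u = 1" "v = 2" | (c21) "u = 2" "v = 1"
    | (c1) "u \<noteq> v" "(u, v) \<in> parcs (tree3 a b)" "u = 1 \<and> v \<noteq> 2 \<or> v = 1 \<and> u \<noteq> 2"
    | (c2) "u \<noteq> v" "(u, v) \<in> parcs (tree3 a b)" "u = 2 \<and> v \<noteq> 1 \<or> v = 2 \<and> u \<noteq> 1"
    unfolding tree3_def Let_def by fastforce
  then show ?thesis
  proof cases
    case eq
    then show ?thesis using assms by (subst eq, subst graph_dist_0) (auto simp: defs)
  next
    case nonadj
    then show ?thesis using assms by (subst graph_dist_1) (auto simp: defs)
  next
    case c12
    then show ?thesis unfolding c12 by (subst graph_dist_3[of 1 3 0 2]) (auto simp: defs)
  next
    case c21
    then show ?thesis unfolding c21 by (subst graph_dist_3[of 2 0 3 1]) (auto simp: defs)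
  next
    case c1
    then show ?thesis using assms by (subst graph_dist_2[of u 3 v]) (auto simp: defs)
  next
    case c2
    then show ?thesis using assms by (subst graph_dist_2[of u 0 v]) (auto simp: defs)
  qed
qed

lemma eccentricity_complement_tree3:
  assumes "u < a + b + 4"
  shows "eccentricity (graph_complement (tree3 a b)) u = ereal (if u \<in> {1, 2} then 3 else 2)"
proof -
  let ?H = "graph_complement (tree3 a b)" and ?e = "ereal (if u \<in> {1, 2} then 3 else 2)"
  \<comment> \<open>\<open>w\<close> is a centre adjacent to \<open>u\<close> in the tree: the other
    centre if \<open>u\<close> is one, and otherwise the only neighbour of the leaf
    \<open>u\<close>.\<close>
  define w :: nat where "w = (if u = 0 \<or> u = 2 \<or> 4 \<le> u \<and> u < a + 4 then 1 else 2)"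
  have w: "w \<in> {..<a + b + 4}"
    by (simp add: w_def)
  have attained: "?e = graph_dist ?H u w"
    using assms w by (subst graph_dist_complement_tree3) (auto simp: w_def tree3_def Let_def)
  have upper: "graph_dist ?H u v \<le> ?e" if "v \<in> {..<a + b + 4}" for v
    using assms that by (subst graph_dist_complement_tree3) (auto simp: tree3_def Let_def)
  have V: "pverts ?H = {..<a + b + 4}"
    by (simp add: graph_complement_def tree3_def Let_def)
  show ?thesis
    unfolding eccentricity_def V
  proof (rule Max_eqI)
    show "?e \<in> graph_dist ?H u ` {..<a + b + 4}"
      using attained w by (rule image_eqI)
    show "d \<le> ?e" if "d \<in> graph_dist ?H u ` {..<a + b + 4}" for d
      using that upper by blast
  qed simp
qed

text \<open>Eccentricities are at least 2, so pairs at distance 0 or 1 give 0. A pendant edge has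
  eccentricities 2 and 3 and distance 2; the central edge has 3 throughout.\<close>

lemma ecc_matrix_complement_tree3:
  "ecc_matrix (graph_complement (tree3 a b)) = double_star_mat a b"
proof -
  let ?H = "graph_complement (tree3 a b)"
  \<comment> \<open>As an interval from 0, the vertex set is listed so that position
    \<open>i\<close> holds vertex \<open>i\<close>.\<close>
  have V: "pverts ?H = {0..<a + b + 4}"
    by (auto simp: graph_complement_def tree3_def Let_def)
  let ?D = "mat (a + b + 4) (a + b + 4) (\<lambda>(u, v).
      if (u, v) \<in> parcs (tree3 a b) then if u \<in> {1, 2} \<and> v \<in> {1, 2} then 3 else 2 else 0) :: real mat"
  have "ecc_matrix ?H = ?D"
  proof (rule eq_matI)
    fix u v
    assume "u < dim_row ?D" "v < dim_col ?D"
    then have uv: "u < a + b + 4" "v < a + b + 4"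
      by simp_all
    have "(u, v) \<in> parcs (tree3 a b) \<Longrightarrow> u \<noteq> v \<and> (u \<in> {1, 2} \<or> v \<in> {1, 2})"
      by (auto simp: tree3_def Let_def)
    then show "ecc_matrix ?H $$ (u, v) = ?D $$ (u, v)"
      unfolding ecc_matrix_def Let_def V
      using uv by (auto simp: graph_dist_complement_tree3 eccentricity_complement_tree3
          min_def simp del: upt_Suc)
  qed (simp_all add: ecc_matrix_def Let_def V)
  also have "\<dots> = double_star_mat a b"
  proof (rule eq_matI)
    fix i j
    assume "i < dim_row (double_star_mat a b)" "j < dim_col (double_star_mat a b)"
    then have ij: "i < a + b + 4" "j < a + b + 4"
      by (simp_all add: double_star_mat_def)
    note defs = double_star_mat_def tree3_def Let_def
    show "?D $$ (i, j) = double_star_mat a b $$ (i, j)"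
    proof (cases "i < 4"; cases "j < 4")
      assume "i < 4" "j < 4"
      then show ?thesis
        by (auto simp: defs dest!: less_4_cases)
    next
      assume "i < 4" "\<not> j < 4"
      then show ?thesis
        using ij less_4_cases[OF \<open>i < 4\<close>] by - (elim disjE; auto simp: defs)
    next
      assume "\<not> i < 4" "j < 4"
      then show ?thesis
        using ij less_4_cases[OF \<open>j < 4\<close>] by - (elim disjE; auto simp: defs)
    next
      assume "\<not> i < 4" "\<not> j < 4"
      then show ?thesis
        using ij by (auto simp: defs)
    qed
  qed (simp_all add: double_star_mat_def)
  finally show ?thesis .
qed

section \<open>The second eigenvalue and its growth\<close>

lemma ecc_eigval_2_complement_tree3:
  fixes a b :: nat
  defines "s \<equiv> 4 * real (a + 1) + 4 * real (b + 1) + 9"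
    and "t \<equiv> 8 * sqrt (real (a + 1) * real (b + 1))"
  shows "0 < t" "t < s"
    and "\<xi> 2 (graph_complement (tree3 a b)) = (sqrt (s + t) - sqrt (s - t)) / 2"
proof -
  show t: "0 < t"
    by (simp add: t_def)
  \<comment> \<open>By the AM-GM inequality \<open>t\<close> is at most
    \<open>s - 9\<close>.\<close>
  show st: "t < s"
    using arith_geo_mean_sqrt[of "real (a + 1)" "real (b + 1)"] by (simp add: s_def t_def)
  define u w where "u = sqrt (s + t)" and "w = sqrt (s - t)"
  have sq: "u\<^sup>2 = s + t" "w\<^sup>2 = s - t" and uw: "0 < w" "w < u"
    using t st by (simp_all add: u_def w_def)
  have "((u\<^sup>2 - w\<^sup>2) / 4)\<^sup>2 = 16 * real (a + 1) * real (b + 1)"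
    unfolding sq by (simp add: t_def power_mult_distrib power_divide)
  moreover have "(u\<^sup>2 + w\<^sup>2) / 2 = 4 * real (a + 1) + 4 * real (b + 1) + 9"
    unfolding sq by (simp add: s_def)
  ultimately have "char_poly (ecc_matrix (graph_complement (tree3 a b))) =
      [:((u\<^sup>2 - w\<^sup>2) / 4)\<^sup>2, 0, - ((u\<^sup>2 + w\<^sup>2) / 2), 0, 1:] * [:0, 1:] ^ (a + b)"
    by (simp only: ecc_matrix_complement_tree3 char_poly_double_star_mat)
  \<comment> \<open>Position \<open>2 - 1\<close> of the descending list is
    \<open>(u - w) / 2\<close>, the smaller positive root; the zeros come after it.\<close>
  then show "\<xi> 2 (graph_complement (tree3 a b)) = (sqrt (s + t) - sqrt (s - t)) / 2"
    unfolding ecc_eigval_def eigvals_desc_def u_def[symmetric] w_def[symmetric]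
    by (simp only: rev_sorted_proots_biquadratic[OF uw]) simp
qed

theorem theorem4p1:
  fixes n a a' :: nat
  assumes "n \<ge> 4" and "a < a'" and "a' \<le> (n - 4) div 2"
  shows "\<xi> 2 (graph_complement (tree3 a (n - 4 - a)))
       < \<xi> 2 (graph_complement (tree3 a' (n - 4 - a')))"
proof -
  define b b' where "b = n - 4 - a" and "b' = n - 4 - a'"
  \<comment> \<open>The floor bound on \<open>a'\<close> enters as
    \<open>a' \<le> b'\<close>.\<close>
  have sum: "real b = real a' + real b' - real a" and "a' \<le> b'"
    using assms by (auto simp: b_def b'_def)
  \<comment> \<open>At fixed sum the product grows as its factors approach each other; substituting
    for \<open>b\<close> makes the gain factor.\<close>
  have "real (a' + 1) * real (b' + 1) - real (a + 1) * real (b + 1) =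
      (real a' - real a) * (real b' - real a)"
    by (simp add: sum algebra_simps)
  moreover have "0 < (real a' - real a) * (real b' - real a)"
    using \<open>a < a'\<close> \<open>a' \<le> b'\<close> by (intro mult_pos_pos) auto
  ultimately have less: "8 * sqrt (real (a + 1) * real (b + 1)) < 8 * sqrt (real (a' + 1) * real (b' + 1))"
    by simp
  have s: "4 * real (a + 1) + 4 * real (b + 1) + 9 = 4 * real (a' + 1) + 4 * real (b' + 1) + 9"
    by (simp add: sum)
  show ?thesis
    unfolding b_def[symmetric] b'_def[symmetric] ecc_eigval_2_complement_tree3(3) s
    using ecc_eigval_2_complement_tree3(1)[of a b] ecc_eigval_2_complement_tree3(2)[of a' b']
    by (intro divide_strict_right_mono sqrt_diff_less[OF less]) auto
qed

end
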